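(* Fix $T<\infty$ and the unquantized data. Let $\Phi,\Psi$ be the unquantized and $\bar\Phi,\bar\Psi$ the dither-quantized data matrices (quantization resolution $\epsilon$) defined in the context, and suppose that $\Phi,\bar\Phi,\Psi,\bar\Psi$ have full row rank and that Assumptions 1 and 4 of the context hold. Let $G=[A,B]$ and $\bar G=[\tilde A,\tilde B]$ be the least-squares predictors obtained from the unquantized and the quantized data, respectively. Then there exists a matrix $G_\epsilon\in\mathbb{R}^{N\times(N+m)}$ with $\|G_\epsilon\|=O(\epsilon)$ (as $\epsilon\to0$) such that $$\bar G=[\tilde A,\tilde B]=G+G_\epsilon=[A,B]+G_\epsilon .$$
   Context: Setting. $\mathcal{M}\subset\mathbb{R}^n$ is a compact manifold, $\mathcal{U}\subset\mathbb{R}^m$ the set of admissible controls, and $x_{t+1}=f(x_t,u_t)$ with $x_t\in\mathcal{M}$, $u_t\in\mathcal{U}$, $f:\mathcal{M}\times\mathcal{U}\to\mathcal{M}$. The observables are $\varphi=[\varphi^1,\dots,\varphi^N]^\top$, real-valued functions on $\mathbb{R}^n$. $\|\cdot\|$ is the Euclidean norm for vectors and the Frobenius norm for matrices. Unquantized data: $\Phi=[\varphi(x_0)\ \cdots\ \varphi(x_{T-1})]$, $\Phi^+=[\varphi(x_1)\ \cdots\ \varphi(x_T)]$, $U=[u_0\ \cdots\ u_{T-1}]$, $\Psi=\begin{bmatrix} \Phi \\ U \end{bmatrix}\in\mathbb{R}^{(N+m)\times T}$, and $[A,B]=\arg\min_{\mathcal{G}\in\mathbb{R}^{N\times(N+m)}}\frac1T\|\Phi^+-\mathcal{G}\Psi\|^2$.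 Dither quantization. The uniform mid-point quantizer with range $(y_{\min},y_{\max})$, word-length $b$ and resolution $\epsilon=(y_{\max}-y_{\min})/2^b$ is $\mathcal{Q}(y)=\epsilon\lfloor (y-y_{\min})/\epsilon\rfloor+y_{\min}+\epsilon/2$; all quantized quantities are assumed to lie in the range (no saturation). It is applied componentwise: $\tilde x_t=\mathcal{Q}(x_t+w^x_t)-w^x_t$, $\tilde u_t=\mathcal{Q}(u_t+w^u_t)-w^u_t$, where the components of the dither vectors $w^x_t,w^u_t$ are independent and uniform on $[-\epsilon/2,\epsilon/2]$. In particular every component of $\tilde x_t-x_t$ and $\tilde u_t-u_t$ has absolute value at most $\epsilon/2$. Quantized data: $\bar\Phi=[\varphi(\tilde x_0)\ \cdots\ \varphi(\tilde x_{T-1})]$, $\bar\Phi^+=[\varphi(\tilde x_1)\ \cdots\ \varphi(\tilde x_T)]$, $\bar U=[\tilde u_0\ \cdots\ \tilde u_{T-1}]$, $\bar\Psi=\begin{bmatrix} \bar\Phi \\ \bar U \end{bmatrix}$, and $[\tilde A,\tilde B]=\arg\min_{\mathcal{G}\in\mathbb{R}^{N\times(N+m)}}\frac1T\|\bar\Phi^+-\mathcal{G}\bar\Psi\|^2$. Assumption 1: the observables are bounded functions on $\mathbb{R}^n$ and the inputs $u_t$ are bounded. Assumption 4: there is $c_\varphi>0$ with $\|\nabla\varphi^i(x)\|\le c_\varphi$ for all $x\in\mathbb{R}^n$ and $i=1,\dots,N$. *)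

theory Defs
  imports "HOL-Analysis.Analysis" "HOL-Probability.Probability"
begin

text \<open>Topological manifold (without boundary) of some dimension \<open>k\<close>, as a subspace of an
  ambient space; the Hausdorff and second-countability axioms hold automatically for subspaces of
  \<open>\<real>\<^sup>n\<close>. \<open>Euclidean_space k\<close> is the library's \<open>\<real>\<^sup>k\<close> with a term-level dimension.\<close>

definition embedded_manifold :: "('a::topological_space) set \<Rightarrow> bool" where
  "embedded_manifold M \<longleftrightarrow>
     (\<exists>k. \<forall>p\<in>M. \<exists>V W. openin (top_of_set M) V \<and> p \<in> V \<and> openin (Euclidean_space k) W \<and>
        top_of_set V homeomorphic_space subtopology (Euclidean_space k) W)"

definition gradient_bounded_by :: "real \<Rightarrow> ('a::real_inner \<Rightarrow> real) \<Rightarrow> bool" where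
  "gradient_bounded_by c g \<longleftrightarrow> (\<forall>y. \<exists>D. GDERIV g y :> D \<and> norm D \<le> c)"


subsection \<open>Data matrices and least squares\<close>

text \<open>The number \<open>T\<close> of samples is \<open>CARD('t)\<close>; the linear order on the column index type
  identifies it with the time instants \<open>0, \<dots>, T - 1\<close>. The norm on \<open>real^'c^'r\<close> is the
  Frobenius norm.\<close>

definition time_of :: "'t::{finite,linorder} \<Rightarrow> nat" where
  "time_of j = card {..<j}"

definition data_matrix :: "(nat \<Rightarrow> real^'r) \<Rightarrow> real^('t::{finite,linorder})^'r" where
  "data_matrix v = (\<chi> i j. v (time_of j) $ i)"

definition vstack :: "'a^'c^'r \<Rightarrow> 'a^'c^'s \<Rightarrow> 'a^'c^('r + 's)" where
  "vstack P Q = (\<chi> i. case i of Inl k \<Rightarrow> P $ k | Inr l \<Rightarrow> Q $ l)"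

definition hcat :: "'a^'c^'r \<Rightarrow> 'a^'d^'r \<Rightarrow> 'a^('c + 'd)^'r" where
  "hcat P Q = (\<chi> i j. case j of Inl k \<Rightarrow> P $ i $ k | Inr l \<Rightarrow> Q $ i $ l)"

definition obs_data ::
    "(real^'n \<Rightarrow> real^'N) \<Rightarrow> (nat \<Rightarrow> real^'n) \<Rightarrow> real^('t::{finite,linorder})^'N" where
  "obs_data \<phi> x = data_matrix (\<lambda>t. \<phi> (x t))"

definition obs_data_next ::
    "(real^'n \<Rightarrow> real^'N) \<Rightarrow> (nat \<Rightarrow> real^'n) \<Rightarrow> real^('t::{finite,linorder})^'N" where
  "obs_data_next \<phi> x = data_matrix (\<lambda>t. \<phi> (x (Suc t)))"

definition full_data ::
    "(real^'n \<Rightarrow> real^'N) \<Rightarrow> (nat \<Rightarrow> real^'n) \<Rightarrow> (nat \<Rightarrow> real^'m)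
      \<Rightarrow> real^('t::{finite,linorder})^('N + 'm)" where
  "full_data \<phi> x u = vstack (obs_data \<phi> x) (data_matrix u)"

definition full_row_rank :: "real^'c^'r \<Rightarrow> bool" where
  "full_row_rank P \<longleftrightarrow> rank P = CARD('r)"

definition ls_cost :: "real^'t^'N \<Rightarrow> real^'t^'k \<Rightarrow> real^'k^'N \<Rightarrow> real" where
  "ls_cost Y Z G = 1 / real CARD('t) * (norm (Y - G ** Z))\<^sup>2"

definition ls_predictor :: "real^'t^'N \<Rightarrow> real^'t^'k \<Rightarrow> real^'k^'N \<Rightarrow> bool" where
  "ls_predictor Y Z G \<longleftrightarrow> is_arg_min (ls_cost Y Z) (\<lambda>_. True) G"


subsection \<open>Dither quantization\<close>

definition resolution :: "real \<Rightarrow> real \<Rightarrow> nat \<Rightarrow> real" where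
  "resolution ymin ymax b = (ymax - ymin) / 2 ^ b"

definition quantize :: "real \<Rightarrow> real \<Rightarrow> nat \<Rightarrow> real \<Rightarrow> real" where
  "quantize ymin ymax b y =
     (let \<epsilon> = resolution ymin ymax b
      in \<epsilon> * of_int \<lfloor>(y - ymin) / \<epsilon>\<rfloor> + ymin + \<epsilon> / 2)"

definition dither_quantize ::
    "real \<Rightarrow> real \<Rightarrow> nat \<Rightarrow> real^'k \<Rightarrow> real^'k \<Rightarrow> real^'k" where
  "dither_quantize ymin ymax b w v = (\<chi> i. quantize ymin ymax b (v $ i + w $ i)) - w"

definition in_range :: "real \<Rightarrow> real \<Rightarrow> real^'k \<Rightarrow> bool" where
  "in_range ymin ymax v \<longleftrightarrow> (\<forall>i. ymin < v $ i \<and> v $ i < ymax)"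

text \<open>All scalar components of both dither processes, over all times, form one independent
  family of random variables, uniform on \<open>[-\<epsilon>/2, \<epsilon>/2]\<close>.\<close>

definition dither ::
    "'w measure \<Rightarrow> real \<Rightarrow> (nat \<Rightarrow> 'w \<Rightarrow> real^'n) \<Rightarrow> (nat \<Rightarrow> 'w \<Rightarrow> real^'m) \<Rightarrow> bool" where
  "dither P \<epsilon> wx wu \<longleftrightarrow>
     prob_space.indep_vars P (\<lambda>_. borel)
       (\<lambda>(t, k) \<omega>. case k of Inl i \<Rightarrow> wx t \<omega> $ i | Inr j \<Rightarrow> wu t \<omega> $ j)
       (UNIV :: (nat \<times> ('n + 'm)) set) \<and>
     (\<forall>t i. distr P lborel (\<lambda>\<omega>. wx t \<omega> $ i) = uniform_measure lborel {-\<epsilon>/2..\<epsilon>/2}) \<and>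
     (\<forall>t j. distr P lborel (\<lambda>\<omega>. wu t \<omega> $ j) = uniform_measure lborel {-\<epsilon>/2..\<epsilon>/2})"

end

theory Submission
  imports Defs
begin

text \<open>Dither quantization perturbs every component by at most \<open>\<epsilon>/2\<close>, whatever the value of the
  dither, so the estimate is deterministic and the data matrices move by \<open>O(\<epsilon>)\<close>. Let \<open>G\<close> and \<open>G'\<close>
  be least-squares solutions for \<open>(Y, Z)\<close> and \<open>(Y', Z')\<close>, and put \<open>D = G' - G\<close>. Orthogonality of
  the residuals gives \<open>\<parallel>D Z'\<parallel>\<^sup>2 = \<langle>(Y' - Y) - G (Z' - Z), D Z'\<rangle> + \<langle>Y - G Z, D (Z' - Z)\<rangle>\<close>, and a
  right inverse of \<open>Z\<close> bounds \<open>\<parallel>D\<parallel>\<close> by a constant times \<open>\<parallel>D Z'\<parallel>\<close> as soon as \<open>Z'\<close> is close to \<open>Z\<close>.\<close>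

text \<open>Cauchy-Schwarz bounds each squared entry of the product by a squared row norm of
  \<open>A\<close> times a squared column norm of \<open>B\<close>, and the sum of these bounds
  factorises.\<close>

lemma norm_matrix_mult_le:
  fixes A :: "real^'k^'r" and B :: "real^'c^'k"
  shows "norm (A ** B) \<le> norm A * norm B"
proof (rule power2_le_imp_le)
  have frob: "(norm X)\<^sup>2 = (\<Sum>i\<in>UNIV. \<Sum>j\<in>UNIV. (X $ i $ j)\<^sup>2)" for X :: "real^'p^'q"
    by (simp add: norm_vec_def L2_set_def sum_nonneg)
  have entry: "((A ** B) $ i $ j)\<^sup>2 \<le> (\<Sum>k\<in>UNIV. (A $ i $ k)\<^sup>2) * (\<Sum>k\<in>UNIV. (B $ k $ j)\<^sup>2)" for i j
    unfolding matrix_matrix_mult_def by (simp add: Cauchy_Schwarz_ineq_sum)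
  have "(norm (A ** B))\<^sup>2
      \<le> (\<Sum>i\<in>UNIV. \<Sum>j\<in>UNIV. (\<Sum>k\<in>UNIV. (A $ i $ k)\<^sup>2) * (\<Sum>k\<in>UNIV. (B $ k $ j)\<^sup>2))"
    unfolding frob by (intro sum_mono entry)
  also have "\<dots> = (norm A)\<^sup>2 * (\<Sum>j\<in>UNIV. \<Sum>k\<in>UNIV. (B $ k $ j)\<^sup>2)"
    by (simp add: frob sum_product)
  also have "\<dots> = (norm A * norm B)\<^sup>2"
    by (subst sum.swap) (simp add: frob power_mult_distrib)
  finally show "(norm (A ** B))\<^sup>2 \<le> (norm A * norm B)\<^sup>2" .
qed simp

text \<open>The 2-norm is bounded by the 1-norm, once inside the rows and once across them. The
  factor is not sharp, but only the order in \<open>e\<close> matters.\<close>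

lemma norm_matrix_le_entries:
  fixes A :: "real^'c^'r"
  assumes "\<And>i j. \<bar>A $ i $ j\<bar> \<le> e"
  shows "norm A \<le> real CARD('r) * real CARD('c) * e"
proof -
  have "norm (A $ i) \<le> real CARD('c) * e" for i
    using norm_le_l1_cart[of "A $ i"] sum_bounded_above[of UNIV "\<lambda>j. \<bar>A $ i $ j\<bar>" e] assms
    by fastforce
  then show ?thesis
    using L2_set_le_sum[of UNIV "\<lambda>i. norm (A $ i)"]
      sum_bounded_above[of UNIV "\<lambda>i. norm (A $ i)" "real CARD('c) * e"]
    by (fastforce simp: norm_vec_def mult.assoc)
qed

lemma matrix_mult_add_rdistrib: "(A + B) ** C = A ** C + B ** (C :: real^'c^'k)"
  by (simp add: vec_eq_iff matrix_matrix_mult_def sum.distrib algebra_simps)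

lemma matrix_mult_diff_rdistrib: "(A - B) ** C = A ** C - B ** (C :: real^'c^'k)"
  using matrix_mult_add_rdistrib[of "A - B" B C] by simp

lemma matrix_mult_diff_ldistrib: "A ** (B - C) = A ** B - A ** (C :: real^'c^'k)"
  using matrix_add_ldistrib[of A "B - C" C] by simp

lemma full_row_rank_right_inverse:
  fixes Z :: "real^'c^'r"
  assumes "full_row_rank Z"
  obtains R where "Z ** R = mat 1"
  using assms full_rank_surjective[of Z] matrix_right_invertible_surjective[of Z]
  unfolding full_row_rank_def by blast

text \<open>Along the line \<open>G + s *\<^sub>R V\<close> the cost is a quadratic in
  \<open>s\<close>; a nonzero inner product would let a suitable step lower it.\<close>

lemma ls_predictor_residual_orthogonal:
  assumes "ls_predictor Y Z G"
  shows "(Y - G ** Z) \<bullet> (V ** Z) = 0"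
proof (rule ccontr)
  define r where "r = Y - G ** Z"
  define w where "w = V ** Z"
  assume "(Y - G ** Z) \<bullet> (V ** Z) \<noteq> 0"
  then have rw: "r \<bullet> w \<noteq> 0" by (simp add: r_def w_def)
  then have w: "w \<bullet> w > 0" by auto
  \<comment> \<open>The minimiser of the squared norm of \<open>r - s *\<^sub>R w\<close>: exact
    line search.\<close>
  define s where "s = (r \<bullet> w) / (w \<bullet> w)"
  have "ls_cost Y Z G \<le> ls_cost Y Z (G + s *\<^sub>R V)"
    using assms by (auto simp: ls_predictor_def is_arg_min_def not_less)
  then have "(norm r)\<^sup>2 \<le> (norm (Y - (G + s *\<^sub>R V) ** Z))\<^sup>2"
    by (simp add: ls_cost_def divide_le_cancel r_def)
  also have "Y - (G + s *\<^sub>R V) ** Z = r - s *\<^sub>R w"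
    by (simp add: r_def w_def matrix_mult_add_rdistrib scalar_matrix_assoc)
  also have "(norm \<dots>)\<^sup>2 = (norm r)\<^sup>2 - 2 * s * (r \<bullet> w) + s\<^sup>2 * (w \<bullet> w)"
    unfolding power2_norm_eq_inner
    by (simp add: inner_diff_left inner_diff_right inner_commute power2_eq_square algebra_simps)
  also have "\<dots> = (norm r)\<^sup>2 - (r \<bullet> w)\<^sup>2 / (w \<bullet> w)"
    using w by (simp add: s_def power2_eq_square field_simps)
  finally have "(r \<bullet> w)\<^sup>2 / (w \<bullet> w) \<le> 0" by simp
  then show False
    using rw w by (simp add: divide_le_0_iff)
qed

text \<open>\<open>C\<close> and \<open>\<delta>\<close> are built from the unperturbed
  \<open>Y\<close>, \<open>Z\<close>, \<open>G\<close> alone, which makes the estimate uniform over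
  all perturbed data.\<close>

lemma ls_predictor_lipschitz_at:
  fixes Y :: "real^'t^'N" and Z :: "real^'t^'k"
  assumes "full_row_rank Z" and "ls_predictor Y Z G"
  obtains C \<delta> where "C > 0" and "\<delta> > 0"
    and "\<And>Y' Z' G' e. \<lbrakk>ls_predictor Y' Z' G'; norm (Y' - Y) \<le> e; norm (Z' - Z) \<le> e; e \<le> \<delta>\<rbrakk>
      \<Longrightarrow> norm (G' - G) \<le> C * e"
proof -
  obtain R where R: "Z ** R = mat 1"
    using full_row_rank_right_inverse[OF assms(1)] .
  \<comment> \<open>The added 1 gives positivity at once, so that division by \<open>r\<close> is
    allowed.\<close>
  define r where "r = norm R + 1"
  have r: "r > 0" by (simp add: r_def add_nonneg_pos)
  define q where "q = norm (Y - G ** Z)"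
  \<comment> \<open>The outer \<open>2 * r\<close> converts a bound on \<open>d\<close> into one on
    \<open>norm D\<close>; in the bracket, \<open>1 + norm G\<close> comes from \<open>E\<close> and
    \<open>2 * r * q\<close> from the residual of \<open>G\<close>.\<close>
  define C where "C = 2 * r * (1 + norm G + 2 * r * q)"
  have "C > 0"
    using r by (simp add: C_def q_def add_pos_nonneg)
  moreover have "1 / (2 * r) > 0" using r by simp
  moreover have "norm (G' - G) \<le> C * e"
    if ls: "ls_predictor Y' Z' G'" and Y: "norm (Y' - Y) \<le> e" and Z: "norm (Z' - Z) \<le> e"
      and e: "e \<le> 1 / (2 * r)" for Y' Z' G' e
  proof -
    define D where "D = G' - G"
    \<comment> \<open>The change of the residual when the data are perturbed and \<open>G\<close> is
      kept.\<close>
    define E where "E = (Y' - Y) - G ** (Z' - Z)"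
    define d where "d = norm (D ** Z')"
    have e0: "0 \<le> e" using Y norm_ge_zero[of "Y' - Y"] by linarith
    \<comment> \<open>The right inverse recovers \<open>D\<close> from \<open>D ** Z\<close>;
      replacing \<open>Z\<close> by \<open>Z'\<close> then costs \<open>norm D * e\<close>.\<close>
    have "norm D = norm (D ** Z ** R)"
      by (simp add: R flip: matrix_mul_assoc)
    also have "\<dots> \<le> norm (D ** Z) * r"
      using norm_matrix_mult_le[of "D ** Z" R] by (simp add: r_def distrib_left add_increasing2)
    also have "D ** Z = D ** Z' - D ** (Z' - Z)"
      by (simp add: matrix_mult_diff_ldistrib)
    also have "norm \<dots> \<le> d + norm D * e"
      using norm_triangle_ineq4[of "D ** Z'" "D ** (Z' - Z)"] norm_matrix_mult_le[of D "Z' - Z"]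
        mult_left_mono[OF Z norm_ge_zero[of D]] by (simp add: d_def)
    finally have "norm D \<le> d * r + norm D * (e * r)"
      using r by (simp add: algebra_simps)
    \<comment> \<open>The threshold \<open>1 / (2 * r)\<close> is chosen so that this term is
      absorbed into the left-hand side.\<close>
    moreover have "norm D * (e * r) \<le> norm D * (1 / 2)"
      using e r by (intro mult_left_mono) (auto simp: field_simps)
    ultimately have D: "norm D \<le> 2 * r * d" by (simp add: algebra_simps)
    have "norm E \<le> e + norm G * e"
      using norm_triangle_ineq4[of "Y' - Y" "G ** (Z' - Z)"] norm_matrix_mult_le[of G "Z' - Z"]
        mult_left_mono[OF Z norm_ge_zero[of G]] Y by (simp add: E_def)
    then have E: "E \<bullet> (D ** Z') \<le> (e + norm G * e) * d"
      using norm_cauchy_schwarz[of E "D ** Z'"] mult_right_mono[of "norm E" _ d]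
      by (fastforce simp: d_def)
    have "norm (D ** (Z' - Z)) \<le> 2 * r * d * e"
      using norm_matrix_mult_le[of D "Z' - Z"] mult_mono[OF D Z] r by (simp add: d_def)
    then have F: "(Y - G ** Z) \<bullet> (D ** (Z' - Z)) \<le> q * (2 * r * d * e)"
      using norm_cauchy_schwarz[of "Y - G ** Z" "D ** (Z' - Z)"] mult_left_mono[of _ _ q]
      by (fastforce simp: q_def)
    \<comment> \<open>The left-hand side is orthogonal to \<open>D ** Z'\<close>, so pairing with
      \<open>D ** Z'\<close> isolates the square of \<open>d\<close>.\<close>
    have "Y' - G' ** Z' = E + (Y - G ** Z) - D ** Z'"
      by (simp add: E_def D_def matrix_mult_diff_ldistrib matrix_mult_diff_rdistrib)
    then have "d\<^sup>2 = E \<bullet> (D ** Z') + (Y - G ** Z) \<bullet> (D ** Z')"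
      using ls_predictor_residual_orthogonal[OF ls, of D]
      by (simp add: d_def power2_norm_eq_inner inner_diff_left inner_add_left)
    \<comment> \<open>The old residual is orthogonal to \<open>D ** Z\<close>; subtracting that
      gains a factor \<open>e\<close>.\<close>
    also have "(Y - G ** Z) \<bullet> (D ** Z') = (Y - G ** Z) \<bullet> (D ** (Z' - Z))"
      using ls_predictor_residual_orthogonal[OF assms(2), of D]
      by (simp add: matrix_mult_diff_ldistrib inner_diff_right)
    finally have "d * d \<le> ((1 + norm G + 2 * r * q) * e) * d"
      using E F by (simp add: power2_eq_square algebra_simps)
    \<comment> \<open>Settles the case \<open>d = 0\<close>, where the common factor
      \<open>d\<close> cannot be cancelled.\<close>
    moreover have "0 \<le> (1 + norm G + 2 * r * q) * e"
      using e0 r by (simp add: q_def)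
    ultimately have "d \<le> (1 + norm G + 2 * r * q) * e"
      by (metis d_def mult_le_cancel_right norm_ge_zero order_le_less)
    then have "2 * r * d \<le> C * e"
      using r by (simp add: C_def mult.assoc)
    with D show ?thesis by (simp add: D_def)
  qed
  ultimately show thesis by (rule that)
qed

text \<open>Mean value inequality on the whole space, which is convex; Cauchy-Schwarz bounds the
  operator norm of the derivative by that of the gradient.\<close>

lemma gradient_bounded_by_lipschitz:
  assumes "gradient_bounded_by c g"
  shows "\<bar>g y - g z\<bar> \<le> c * norm (y - z)"
proof -
  obtain D where D: "\<And>y. GDERIV g y :> D y" "\<And>y. norm (D y) \<le> c"
    using assms unfolding gradient_bounded_by_def by metis
  have "onorm (\<lambda>h. h \<bullet> D y) \<le> c" for y
  proof (rule onorm_bound)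
    show "0 \<le> c" using D(2) norm_ge_zero order_trans by blast
    fix h
    show "norm (h \<bullet> D y) \<le> c * norm h"
      using Cauchy_Schwarz_ineq2[of h "D y"] mult_left_mono[OF D(2)[of y] norm_ge_zero[of h]]
      by (simp add: mult.commute)
  qed
  then have "norm (g y - g z) \<le> c * norm (y - z)"
    using D(1) unfolding gderiv_def by (intro differentiable_bound[of UNIV]) auto
  then show ?thesis by simp
qed

text \<open>The output is the midpoint of the cell of width \<epsilon> that contains
  \<open>y\<close>.\<close>

lemma quantize_error:
  assumes "resolution ymin ymax b > 0"
  shows "\<bar>quantize ymin ymax b y - y\<bar> \<le> resolution ymin ymax b / 2"
proof -
  define \<epsilon> where "\<epsilon> = resolution ymin ymax b"
  define z where "z = (y - ymin) / \<epsilon>"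
  have \<epsilon>: "\<epsilon> > 0" using assms by (simp add: \<epsilon>_def)
  have y: "y = \<epsilon> * z + ymin" using \<epsilon> by (simp add: z_def)
  have "\<epsilon> * of_int \<lfloor>z\<rfloor> \<le> \<epsilon> * z" "\<epsilon> * z \<le> \<epsilon> * (of_int \<lfloor>z\<rfloor> + 1)"
    using \<epsilon> by (intro mult_left_mono; linarith)+
  then have "\<bar>\<epsilon> * of_int \<lfloor>z\<rfloor> + ymin + \<epsilon> / 2 - y\<bar> \<le> \<epsilon> / 2"
    unfolding y abs_le_iff by (simp add: algebra_simps)
  then show ?thesis
    by (simp add: quantize_def Let_def \<epsilon>_def z_def)
qed

text \<open>The dither added before quantization is subtracted afterwards, so the error is that of
  the quantizer at \<open>v $ i + w $ i\<close>.\<close>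

lemma dither_quantize_error:
  assumes "resolution ymin ymax b > 0"
  shows "\<bar>dither_quantize ymin ymax b w v $ i - v $ i\<bar> \<le> resolution ymin ymax b / 2"
  using quantize_error[OF assms, of "v $ i + w $ i"]
  by (simp add: dither_quantize_def algebra_simps)

lemma observable_error:
  fixes x y :: "real^'n"
  assumes "gradient_bounded_by c g" and "c \<ge> 0" and "\<And>i. \<bar>y $ i - x $ i\<bar> \<le> e"
  shows "\<bar>g y - g x\<bar> \<le> c * real CARD('n) * e"
proof -
  have "norm (y - x) \<le> real CARD('n) * e"
    using norm_le_l1_cart[of "y - x"] sum_bounded_above[of UNIV "\<lambda>i. \<bar>(y - x) $ i\<bar>" e] assms(3)
    by fastforce
  then show ?thesis
    using gradient_bounded_by_lipschitz[OF assms(1), of y x] mult_left_mono[OF _ assms(2)]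
    by (fastforce simp: mult.assoc)
qed

text \<open>The constant and the range of small \<epsilon> are fixed before the quantizer, the
  dither and the outcome \<omega>, so the order bound is uniform in all of them and holds surely,
  not just almost surely.\<close>

theorem theorem2:
  fixes M :: "(real^'n) set" and \<U> :: "(real^'m) set"
    and f :: "(real^'n) \<times> (real^'m) \<Rightarrow> real^'n"
    and \<phi> :: "real^'n \<Rightarrow> real^'N"
    and x :: "nat \<Rightarrow> real^'n" and u :: "nat \<Rightarrow> real^'m"
    and \<Phi> \<Phi>\<^sub>p :: "real^('t::{finite,linorder})^'N"
    and \<Psi> :: "real^('t::{finite,linorder})^('N + 'm)"
    and A :: "real^'N^'N" and B :: "real^'m^'N"
    and c :: real
  assumes "compact M" and "embedded_manifold M"
    and "f ` (M \<times> \<U>) \<subseteq> M"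
    and "x 0 \<in> M" and "\<And>t. u t \<in> \<U>" and "\<And>t. x (Suc t) = f (x t, u t)"
    and "\<And>i. bounded (range (\<lambda>y. \<phi> y $ i))" and "bounded (range u)"
    and "c > 0" and "\<And>i. gradient_bounded_by c (\<lambda>y. \<phi> y $ i)"
    and "\<Phi> = obs_data \<phi> x" and "\<Phi>\<^sub>p = obs_data_next \<phi> x" and "\<Psi> = full_data \<phi> x u"
    and "full_row_rank \<Phi>" and "full_row_rank \<Psi>"
    and "ls_predictor \<Phi>\<^sub>p \<Psi> (hcat A B)"
  shows "\<exists>C>0. \<forall>\<^sub>F \<epsilon> in at_right 0.
    \<forall>ymin ymax b (P :: 'w measure) wx wu.
      ymin < ymax \<longrightarrow> \<epsilon> = resolution ymin ymax b \<longrightarrow> prob_space P \<longrightarrow> dither P \<epsilon> wx wu \<longrightarrow>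
      (\<forall>\<omega>\<in>space P. \<forall>xq uq.
        \<forall>(\<Phi>q :: real^('t::{finite,linorder})^'N) (\<Phi>q\<^sub>p :: real^('t::{finite,linorder})^'N).
        \<forall>\<Psi>q :: real^('t::{finite,linorder})^('N + 'm). \<forall>Aq Bq.
        (\<forall>t\<le>CARD('t). in_range ymin ymax (x t + wx t \<omega>)) \<longrightarrow>
        (\<forall>t<CARD('t). in_range ymin ymax (u t + wu t \<omega>)) \<longrightarrow>
        (\<forall>t. xq t = dither_quantize ymin ymax b (wx t \<omega>) (x t)) \<longrightarrow>
        (\<forall>t. uq t = dither_quantize ymin ymax b (wu t \<omega>) (u t)) \<longrightarrow>
        \<Phi>q = obs_data \<phi> xq \<longrightarrow> \<Phi>q\<^sub>p = obs_data_next \<phi> xq \<longrightarrow> \<Psi>q = full_data \<phi> xq uq \<longrightarrow>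
        full_row_rank \<Phi>q \<longrightarrow> full_row_rank \<Psi>q \<longrightarrow>
        ls_predictor \<Phi>q\<^sub>p \<Psi>q (hcat Aq Bq) \<longrightarrow>
        (\<exists>G\<epsilon> :: real^('N + 'm)^'N. hcat Aq Bq = hcat A B + G\<epsilon> \<and> norm G\<epsilon> \<le> C * \<epsilon>))"
proof -
  obtain C \<delta> where C: "C > 0" "\<delta> > 0"
    and stable: "\<And>Y' Z' G' e. \<lbrakk>ls_predictor Y' Z' G'; norm (Y' - \<Phi>\<^sub>p) \<le> e; norm (Z' - \<Psi>) \<le> e;
      e \<le> \<delta>\<rbrakk> \<Longrightarrow> norm (G' - hcat A B) \<le> C * e"
    using ls_predictor_lipschitz_at[OF assms(15,16)] by metis
  \<comment> \<open>One constant for both kinds of entries: the first summand serves the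
    observables, the 1 serves the inputs.\<close>
  define L where "L = c * real CARD('n) + 1"
  \<comment> \<open>Counts the entries of \<Psi>, the taller matrix, so that it also covers
    \<open>\<Phi>\<^sub>p\<close>.\<close>
  define K where "K = real CARD('N + 'm) * real CARD('t) * L"
  have L: "L \<ge> 1" using \<open>c > 0\<close> by (simp add: L_def)
  have K: "K > 0" using L by (simp add: K_def add_pos_pos)
  \<comment> \<open>The deterministic core, for one fixed outcome. Below \<open>\<delta> / K\<close>
    the data error \<open>K * \<epsilon>\<close> stays within the radius \<delta> of
    \<open>stable\<close>.\<close>
  have bound: "norm (G - hcat A B) \<le> C * K * \<epsilon>"
    if \<epsilon>: "0 < \<epsilon>" "\<epsilon> < \<delta> / K" "\<epsilon> = resolution ymin ymax b"
      and xq: "\<And>t. xq t = dither_quantize ymin ymax b (wx t \<omega>) (x t)"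
      and uq: "\<And>t. uq t = dither_quantize ymin ymax b (wu t \<omega>) (u t)"
      and ls: "ls_predictor (obs_data_next \<phi> xq :: real^('t::{finite,linorder})^'N) (full_data \<phi> xq uq) G"
    for \<epsilon> ymin ymax b xq uq G and wx :: "nat \<Rightarrow> 'w \<Rightarrow> real^'n" and wu :: "nat \<Rightarrow> 'w \<Rightarrow> real^'m" and \<omega>
  proof -
    have res: "resolution ymin ymax b > 0" using \<epsilon> by simp
    have "\<bar>\<phi> (xq t) $ i - \<phi> (x t) $ i\<bar> \<le> c * real CARD('n) * (\<epsilon> / 2)" for t i
      using assms(9,10) dither_quantize_error[OF res]
      by (intro observable_error[where g = "\<lambda>y. \<phi> y $ i"]) (auto simp: xq \<epsilon>(3))
    moreover have "c * real CARD('n) * (\<epsilon> / 2) \<le> L * \<epsilon>"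
      using \<open>c > 0\<close> \<epsilon>(1) unfolding L_def by (intro mult_mono) auto
    ultimately have \<phi>: "\<bar>\<phi> (xq t) $ i - \<phi> (x t) $ i\<bar> \<le> L * \<epsilon>" for t i
      using order_trans by blast
    have "\<epsilon> / 2 \<le> L * \<epsilon>"
      using mult_right_mono[OF L, of \<epsilon>] \<epsilon>(1) by simp
    then have u: "\<bar>uq t $ i - u t $ i\<bar> \<le> L * \<epsilon>" for t i
      using dither_quantize_error[OF res, of "wu t \<omega>" "u t" i] by (simp add: uq \<epsilon>(3))
    have "norm (obs_data_next \<phi> xq - \<Phi>\<^sub>p) \<le> real CARD('N) * real CARD('t) * (L * \<epsilon>)"
      using \<phi> by (intro norm_matrix_le_entries)
        (simp add: \<open>\<Phi>\<^sub>p = _\<close> obs_data_next_def data_matrix_def)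
    also have "\<dots> \<le> K * \<epsilon>"
      using L \<epsilon>(1) by (simp add: K_def mult.assoc mult_right_mono)
    finally have "norm (obs_data_next \<phi> xq - \<Phi>\<^sub>p) \<le> K * \<epsilon>" .
    moreover have "norm (full_data \<phi> xq uq - \<Psi>) \<le> K * \<epsilon>"
      unfolding K_def mult.assoc[of _ L] using \<phi> u
      by (intro norm_matrix_le_entries)
        (simp add: \<open>\<Psi> = _\<close> full_data_def vstack_def obs_data_def data_matrix_def split: sum.split)
    moreover have "K * \<epsilon> \<le> \<delta>"
      using \<epsilon>(2) K by (simp add: field_simps)
    ultimately show ?thesis
      using stable[OF ls, of "K * \<epsilon>"] by (simp add: mult.assoc)
  qed
  have "C * K > 0" using C K by simp
  moreover have "\<forall>\<^sub>F \<epsilon> in at_right 0. 0 < \<epsilon> \<and> \<epsilon> < \<delta> / K"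
    using C K by (auto simp: eventually_at_right intro!: exI[of _ "\<delta> / K"])
  ultimately show ?thesis
  proof (intro exI[of _ "C * K"] conjI; (elim eventually_mono)?; (intro allI impI ballI)?)
    fix \<epsilon> ymin ymax b and P :: "'w measure" and wx :: "nat \<Rightarrow> 'w \<Rightarrow> real^'n"
      and wu :: "nat \<Rightarrow> 'w \<Rightarrow> real^'m" and \<omega> xq uq
      and \<Phi>q \<Phi>q\<^sub>p :: "real^('t::{finite,linorder})^'N"
      and \<Psi>q :: "real^('t::{finite,linorder})^('N + 'm)" and Aq Bq
    assume "0 < \<epsilon> \<and> \<epsilon> < \<delta> / K" and "\<epsilon> = resolution ymin ymax b"
      and "\<forall>t. xq t = dither_quantize ymin ymax b (wx t \<omega>) (x t)"
      and "\<forall>t. uq t = dither_quantize ymin ymax b (wu t \<omega>) (u t)"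
      and "\<Phi>q\<^sub>p = obs_data_next \<phi> xq" and "\<Psi>q = full_data \<phi> xq uq"
      and "ls_predictor \<Phi>q\<^sub>p \<Psi>q (hcat Aq Bq)"
    then have "norm (hcat Aq Bq - hcat A B) \<le> C * K * \<epsilon>"
      by (intro bound[of \<epsilon> ymin ymax b xq wx \<omega> uq wu]) auto
    then show "\<exists>G\<epsilon>. hcat Aq Bq = hcat A B + G\<epsilon> \<and> norm G\<epsilon> \<le> C * K * \<epsilon>"
      by (intro exI[of _ "hcat Aq Bq - hcat A B"]) simp
  qed
qed

end
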